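(* Let $k$ be a positive integer. The function $h_k \circ f_k : \mathbb{N} \to \mathbb{N}^k$ has an inverse function $\Psi_k : \mathbb{N}^k \to \mathbb{N}$, given for all $\boldsymbol{n} = (n_1,\dots,n_k) \in \mathbb{N}^k$ by $$\Psi_k(\boldsymbol{n}) = \sum_{i=1}^{k}\binom{i-1+n_1+ \dots + n_i}{i}.$$
   Context: $\mathbb{N} = \{0,1,2,\dots\}$. The $i$-th coordinate of $\boldsymbol{n} \in \mathbb{N}^k$ is $n_i$. The lexicographic order $<_k$ on $\mathbb{N}^k$ is defined by: $\boldsymbol{m} <_k \boldsymbol{n}$ if and only if there is $i \in \{1,\dots,k\}$ such that $m_i < n_i$ and $i$ is the least index at which $\boldsymbol{m}$ and $\boldsymbol{n}$ differ. Let $\mathcal{D}_k = \{ \boldsymbol{n} \in \mathbb{N}^k \mid n_1 \geq \dots \geq n_k \}$, ordered by the restriction of $<_k$; this is a well-ordered set without maximum. The function $f_k : \mathbb{N} \to \mathcal{D}_k$ is defined recursively by $f_k(0) = \min \mathcal{D}_k$ and $f_k(x+1) = \min\{ \boldsymbol{n} \in \mathcal{D}_k \mid f_k(x) <_k \boldsymbol{n}\}$ for all $x \in \mathbb{N}$, minima being taken with respect to $<_k$. The bijection $h_k : \mathcal{D}_k \to \mathbb{N}^k$ is defined by $h_k(\boldsymbol{n}) = (n_k,\, n_{k-1} - n_k,\, n_{k-2} - n_{k-1},\, \dots,\, n_1 - n_2)$. Binomial coefficients $\binom{x}{y}$ with $x,y\in\mathbb{N}$ are the usual ones, with $\binom{x}{y}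 = 0$ if $x < y$. *)

theory Defs
  imports Main "HOL-Library.FuncSet"
begin

(* A tuple in N^k is a function on the index set {1..k}, extensional so that
   equality of functions is equality of tuples. *)
definition nat_tuples :: "nat \<Rightarrow> (nat \<Rightarrow> nat) set" where
  "nat_tuples k = {1..k} \<rightarrow>\<^sub>E (UNIV :: nat set)"

definition lex_less :: "nat \<Rightarrow> (nat \<Rightarrow> nat) \<Rightarrow> (nat \<Rightarrow> nat) \<Rightarrow> bool" where
  "lex_less k m n \<longleftrightarrow> (\<exists>i\<in>{1..k}. m i < n i \<and> (\<forall>j\<in>{1..<i}. m j = n j))"

definition D :: "nat \<Rightarrow> (nat \<Rightarrow> nat) set" where
  "D k = {n \<in> nat_tuples k. \<forall>i\<in>{1..<k}. n (Suc i) \<le> n i}"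

definition lex_min :: "nat \<Rightarrow> (nat \<Rightarrow> nat) set \<Rightarrow> (nat \<Rightarrow> nat)" where
  "lex_min k A = (THE n. n \<in> A \<and> (\<forall>m\<in>A. m = n \<or> lex_less k n m))"

primrec f :: "nat \<Rightarrow> nat \<Rightarrow> (nat \<Rightarrow> nat)" where
  "f k 0 = lex_min k (D k)"
| "f k (Suc x) = lex_min k {n \<in> D k. lex_less k (f k x) n}"

(* The natural-number subtraction never truncates for n in D k. *)
definition h :: "nat \<Rightarrow> (nat \<Rightarrow> nat) \<Rightarrow> (nat \<Rightarrow> nat)" where
  "h k n = (\<lambda>i\<in>{1..k}. if i = 1 then n k else n (k + 1 - i) - n (k + 2 - i))"

definition Psi :: "nat \<Rightarrow> (nat \<Rightarrow> nat) \<Rightarrow> nat" where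
  "Psi k n = (\<Sum>i=1..k. (i - 1 + (\<Sum>j=1..i. n j)) choose i)"

end

theory Submission
  imports Defs
begin

text \<open>
  The proof identifies \<open>f k\<close> with the inverse of a ranking function on \<open>D k\<close>.  The partial sums
  of the tuple \<open>h k n\<close> telescope to the entries of \<open>n\<close> read backwards, so that \<open>Psi k (h k n)\<close>
  is the sum \<open>rank k n\<close> of the binomials \<open>(i - 1 + n (k + 1 - i)) choose i\<close> (\<open>Psi_h\<close>).  This is
  the combinatorial number system, written for weakly instead of strictly decreasing tuples.

  For \<open>k > 0\<close>, \<open>rank k\<close> is an order isomorphism from \<open>D k\<close> onto the natural numbers.  It is
  strictly increasing (\<open>rank_strict_mono\<close>): by the hockey-stick identity, raising an entry gains
  more than all later entries can contribute together.  It is onto (\<open>rank_surj\<close>): by Pascal's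
  rule, the greedy choice of the largest possible leading binomial leaves a remainder small enough
  for the remaining entries not to exceed the first.

  Since \<open>f k\<close> enumerates \<open>D k\<close> in increasing order, induction gives \<open>rank k (f k x) = x\<close>.
  Hence \<open>Psi k\<close> is a left inverse of \<open>h k \<circ> f k\<close>, and surjectivity follows from that of \<open>f k\<close>
  onto \<open>D k\<close> and of \<open>h k\<close>, whose inverse takes partial sums.
\<close>

definition rank :: "nat \<Rightarrow> (nat \<Rightarrow> nat) \<Rightarrow> nat" where
  "rank k n = (\<Sum>i=1..k. (i - 1 + n (k + 1 - i)) choose i)"

section \<open>Sums of binomial coefficients\<close>

lemma hockey_stick:
  "Suc (\<Sum>i=1..p. (i - 1 + c) choose i) = (c + p) choose p"
  by (induction p) (simp_all add: add.commute)

lemma less_binomial: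
  fixes N p :: nat
  assumes "p > 0"
  shows "N < (N + p) choose p"
proof -
  have "Suc N choose N \<le> (N + p) choose N"
    using assms by (intro binomial_right_mono) auto
  then show ?thesis
    using binomial_symmetric[of p "N + p"] by simp
qed

text \<open>
  The greedy expansion in the combinatorial number system.  The upper bound \<open>c\<close> on the digits is
  what lets the induction go through: by Pascal's rule the remainder after the greedy choice
  \<open>d\<close> of the leading digit is below \<open>(d + p) choose p\<close>, so the remaining digits are at most \<open>d\<close>.
\<close>

lemma greedy_expansion:
  fixes N c p :: nat
  assumes "N < (c + p) choose p"
  shows "\<exists>g. (\<forall>i\<in>{1..p}. g i \<le> c) \<and> (\<forall>i\<in>{1..<p}. g i \<le> g (Suc i)) \<and>
             (\<Sum>i=1..p. (i - 1 + g i) choose i) = N"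
  using assms
proof (induction p arbitrary: N c)
  case 0
  then show ?case by simp
next
  case (Suc p)
  define A where "A = {d. (p + d) choose Suc p \<le> N}"
  have bound: "d \<le> c" if "d \<in> A" for d
  proof (rule ccontr)
    assume "\<not> d \<le> c"
    then have "(c + Suc p) choose Suc p \<le> (p + d) choose Suc p"
      by (intro binomial_right_mono) auto
    with that Suc.prems show False by (simp add: A_def)
  qed
  then have fin: "finite A" by (meson finite_nat_set_iff_bounded_le)
  have "0 \<in> A" by (simp add: A_def binomial_eq_0)
  define d where "d = Max A"
  have dA: "d \<in> A" unfolding d_def using fin \<open>0 \<in> A\<close> by (intro Max_in) auto
  have "Suc d \<notin> A" using Max_ge[OF fin, of "Suc d"] by (auto simp: d_def)
  then have "N < (p + d choose p) + (p + d choose Suc p)" by (simp add: A_def)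
  with dA have "N - (p + d choose Suc p) < (d + p) choose p"
    by (simp add: A_def add.commute less_diff_conv2)
  from Suc.IH[OF this] obtain g where g: "\<forall>i\<in>{1..p}. g i \<le> d" "\<forall>i\<in>{1..<p}. g i \<le> g (Suc i)"
    "(\<Sum>i=1..p. (i - 1 + g i) choose i) = N - (p + d choose Suc p)"
    by blast
  let ?g = "g(Suc p := d)"
  have "(\<Sum>i=1..p. (i - 1 + ?g i) choose i) = (\<Sum>i=1..p. (i - 1 + g i) choose i)"
    by (intro sum.cong) auto
  then have "(\<Sum>i=1..Suc p. (i - 1 + ?g i) choose i) = N"
    using g(3) dA by (simp add: A_def)
  moreover have "\<forall>i\<in>{1..Suc p}. ?g i \<le> c"
    using g(1) bound[OF dA] by (auto simp: le_Suc_eq intro: order.trans)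
  moreover have "\<forall>i\<in>{1..<Suc p}. ?g i \<le> ?g (Suc i)"
    using g(1,2) by (auto simp: less_Suc_eq)
  ultimately show ?case by blast
qed

section \<open>The rank of a weakly decreasing tuple\<close>

lemma D_antimono:
  assumes "n \<in> D k" "i \<ge> 1" "i \<le> j" "j \<le> k"
  shows "n j \<le> n i"
  using assms(3,4)
proof (induction rule: dec_induct)
  case (step j)
  then have "n (Suc j) \<le> n j" using assms(1,2) by (simp add: D_def)
  with step show ?case by simp
qed simp

text \<open>
  Let \<open>i\<close> be the first index where the tuples differ and \<open>q\<close> its position counted from the end.
  The entries of \<open>m\<close> from \<open>i\<close> on are at most \<open>m i\<close>, so by the hockey-stick identity they
  contribute less than \<open>(m i + q) choose q\<close>, which the entry \<open>n i > m i\<close> alone already reaches.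
\<close>

lemma rank_strict_mono:
  assumes "m \<in> D k" "n \<in> D k" "lex_less k m n"
  shows "rank k m < rank k n"
proof -
  from assms(3) obtain i where i: "i \<in> {1..k}" "m i < n i" "\<forall>j\<in>{1..<i}. m j = n j"
    by (auto simp: lex_less_def)
  define q where "q = k + 1 - i"
  have q: "1 \<le> q" "q \<le> k" "k + 1 - q = i" using i(1) by (auto simp: q_def)
  let ?t = "\<lambda>n i. (i - 1 + n (k + 1 - i)) choose i"
  have split: "rank k x = (\<Sum>i=1..q. ?t x i) + (\<Sum>i=Suc q..k. ?t x i)" for x
    unfolding rank_def using q sum.ub_add_nat[of 1 q "?t x" "k - q"] by simp
  have "(\<Sum>j=Suc q..k. ?t m j) = (\<Sum>j=Suc q..k. ?t n j)"
  proof (rule sum.cong)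
    fix j assume "j \<in> {Suc q..k}"
    then have "k + 1 - j \<in> {1..<i}" using q i(1) by auto
    then show "?t m j = ?t n j" using i(3) by auto
  qed simp
  moreover have "(\<Sum>j=1..q. ?t m j) \<le> (\<Sum>j=1..q. (j - 1 + m i) choose j)"
  proof (rule sum_mono)
    fix j assume "j \<in> {1..q}"
    then have "m (k + 1 - j) \<le> m i"
      using i(1) q by (intro D_antimono[OF assms(1)]) auto
    then show "?t m j \<le> (j - 1 + m i) choose j"
      by (intro binomial_right_mono) simp
  qed
  moreover have "\<dots> < (m i + q) choose q"
    by (simp add: hockey_stick[symmetric])
  moreover have "\<dots> \<le> ?t n q"
    using q i(2) by (intro binomial_right_mono) auto
  moreover have "\<dots> \<le> (\<Sum>j=1..q. ?t n j)"
    using q by (intro member_le_sum) auto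
  ultimately show ?thesis unfolding split by linarith
qed

lemma lex_less_total:
  assumes "m \<in> D k" "n \<in> D k" "m \<noteq> n"
  shows "lex_less k m n \<or> lex_less k n m"
proof -
  let ?P = "\<lambda>i. i \<in> {1..k} \<and> m i \<noteq> n i"
  define i where "i = (LEAST i. ?P i)"
  have "m \<in> {1..k} \<rightarrow>\<^sub>E UNIV" "n \<in> {1..k} \<rightarrow>\<^sub>E UNIV"
    using assms(1,2) by (simp_all add: D_def nat_tuples_def)
  then have "\<exists>i. ?P i" using assms(3) PiE_ext[of m "{1..k}" "\<lambda>_. UNIV" n] by blast
  then have i: "?P i" unfolding i_def by (rule LeastI_ex)
  have eq: "\<forall>j\<in>{1..<i}. m j = n j"
  proof
    fix j assume j: "j \<in> {1..<i}"
    then have "\<not> ?P j" using not_less_Least[of j ?P] by (simp add: i_def)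
    with i j show "m j = n j" by auto
  qed
  from i consider "m i < n i" | "n i < m i" by linarith
  then show ?thesis
  proof cases
    case 1
    with i eq show ?thesis unfolding lex_less_def by blast
  next
    case 2
    with i eq show ?thesis unfolding lex_less_def by fastforce
  qed
qed

lemma rank_less_iff:
  assumes "m \<in> D k" "n \<in> D k"
  shows "rank k m < rank k n \<longleftrightarrow> lex_less k m n"
  using rank_strict_mono[OF assms] rank_strict_mono[OF assms(2,1)] lex_less_total[OF assms]
  by fastforce

lemma rank_inj:
  assumes "m \<in> D k" "n \<in> D k" "rank k m = rank k n"
  shows "m = n"
  using rank_less_iff[of m k n] rank_less_iff[of n k m] lex_less_total[of m k n] assms by auto

lemma rank_surj:
  assumes "k > 0"
  shows "\<exists>n\<in>D k. rank k n = N"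
proof -
  from greedy_expansion[OF less_binomial[OF assms]] obtain g where
    g: "\<forall>i\<in>{1..<k}. g i \<le> g (Suc i)" "(\<Sum>i=1..k. (i - 1 + g i) choose i) = N"
    by blast
  define n where "n = (\<lambda>i\<in>{1..k}. g (k + 1 - i))"
  have "n (Suc i) \<le> n i" if "i \<in> {1..<k}" for i
  proof -
    have "k - i \<in> {1..<k}" "Suc (k - i) = k + 1 - i" using that by auto
    with g(1) have "g (k - i) \<le> g (k + 1 - i)" by metis
    with that show ?thesis by (simp add: n_def)
  qed
  then have "n \<in> D k" by (simp add: D_def nat_tuples_def n_def)
  moreover have "rank k n = N"
    unfolding rank_def g(2)[symmetric] by (rule sum.cong) (auto simp: n_def)
  ultimately show ?thesis by blast
qed

section \<open>The increasing enumeration\<close>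

lemma lex_min_eq:
  assumes "A \<subseteq> D k" "n \<in> A" "\<And>m. m \<in> A \<Longrightarrow> rank k n \<le> rank k m"
  shows "lex_min k A = n"
  unfolding lex_min_def
proof (rule the_equality)
  show "n \<in> A \<and> (\<forall>m\<in>A. m = n \<or> lex_less k n m)"
  proof (intro conjI ballI)
    fix m assume "m \<in> A"
    then have D: "m \<in> D k" "n \<in> D k" and "\<not> rank k m < rank k n"
      using assms(1,2) assms(3)[of m] by auto
    then show "m = n \<or> lex_less k n m"
      using lex_less_total[OF D] rank_less_iff[OF D] by blast
  qed (rule assms(2))
next
  fix m assume m: "m \<in> A \<and> (\<forall>m'\<in>A. m' = m \<or> lex_less k m m')"
  then have D: "m \<in> D k" "n \<in> D k" and "\<not> rank k m < rank k n"
    using assms(1,2) assms(3)[of m] by auto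
  then show "m = n"
    using m assms(2) rank_less_iff[OF D] by auto
qed

lemma f_in_D_and_rank:
  assumes "k > 0"
  shows "f k x \<in> D k \<and> rank k (f k x) = x"
proof (induction x)
  case 0
  obtain n where "n \<in> D k" "rank k n = 0" using rank_surj[OF assms] by blast
  moreover from this have "lex_min k (D k) = n" by (intro lex_min_eq) auto
  ultimately show ?case by simp
next
  case (Suc x)
  obtain n where n: "n \<in> D k" "rank k n = Suc x" using rank_surj[OF assms] by blast
  have "{m \<in> D k. lex_less k (f k x) m} = {m \<in> D k. x < rank k m}"
    using Suc rank_less_iff[of "f k x" k] by auto
  moreover have "lex_min k {m \<in> D k. x < rank k m} = n"
    using n by (intro lex_min_eq) auto
  ultimately show ?case using n by simp
qed

lemma f_rank:
  assumes "k > 0" "n \<in> D k"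
  shows "f k (rank k n) = n"
  using assms f_in_D_and_rank by (blast intro: rank_inj)

section \<open>Differences and partial sums\<close>

lemma sum_h:
  assumes "n \<in> D k" "1 \<le> i" "i \<le> k"
  shows "(\<Sum>j=1..i. h k n j) = n (k + 1 - i)"
  using assms(2,3)
proof (induction rule: dec_induct)
  case base
  then show ?case by (simp add: h_def)
next
  case (step i)
  have "n (k + 1 - i) \<le> n (k - i)"
    using step by (intro D_antimono[OF assms(1)]) auto
  with step show ?case by (simp add: h_def)
qed

lemma Psi_h:
  assumes "n \<in> D k"
  shows "Psi k (h k n) = rank k n"
  unfolding Psi_def rank_def using sum_h[OF assms] by (intro sum.cong) auto

lemma h_in_nat_tuples: "h k n \<in> nat_tuples k"
  by (simp add: h_def nat_tuples_def)

lemma h_surj: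
  assumes "n \<in> nat_tuples k"
  shows "\<exists>m\<in>D k. h k m = n"
proof
  define m where "m = (\<lambda>i\<in>{1..k}. \<Sum>j=1..k + 1 - i. n j)"
  show "m \<in> D k"
    by (auto simp: D_def nat_tuples_def m_def intro!: sum_mono2)
  show "h k m = n"
  proof (rule PiE_ext)
    show "h k m \<in> {1..k} \<rightarrow>\<^sub>E UNIV" "n \<in> {1..k} \<rightarrow>\<^sub>E UNIV"
      using h_in_nat_tuples assms by (auto simp: nat_tuples_def)
  next
    fix i assume i: "i \<in> {1..k}"
    show "h k m i = n i"
    proof (cases "i = 1")
      case True
      then show ?thesis using i by (simp add: h_def m_def)
    next
      case False
      then obtain j where j: "i = Suc j" "1 \<le> j" using i by (cases i) auto
      have "m (k + 1 - i) = (\<Sum>j=1..i. n j)" "m (k + 2 - i) = (\<Sum>j=1..j. n j)"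
        using i j by (auto simp: m_def Suc_diff_le)
      then show ?thesis using i j by (simp add: h_def)
    qed
  qed
qed

section \<open>The inverse function\<close>

theorem mainTheorem1:
  fixes k :: nat
  assumes "k > 0"
  shows "bij_betw (h k \<circ> f k) UNIV (nat_tuples k) \<and>
         (\<forall>n\<in>nat_tuples k. the_inv_into UNIV (h k \<circ> f k) n = Psi k n)"
proof -
  have left_inv: "Psi k ((h k \<circ> f k) x) = x" for x
    using f_in_D_and_rank[OF assms, of x] by (simp add: Psi_h)
  have surj: "\<exists>x. (h k \<circ> f k) x = n" if "n \<in> nat_tuples k" for n
    using h_surj[OF that] f_rank[OF assms] by (metis comp_apply)
  have inj: "inj (h k \<circ> f k)"
    using left_inv by (intro inj_on_inverseI[where g = "Psi k"])
  have "range (h k \<circ> f k) = nat_tuples k"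
    using surj by (fastforce simp: h_in_nat_tuples)
  with inj have "bij_betw (h k \<circ> f k) UNIV (nat_tuples k)"
    by (simp add: bij_betw_def)
  moreover have "the_inv_into UNIV (h k \<circ> f k) n = Psi k n" if "n \<in> nat_tuples k" for n
    using surj[OF that] left_inv the_inv_into_f_f[OF inj UNIV_I] by metis
  ultimately show ?thesis by blast
qed

end
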